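(* Let $\mathbb{A}\in\mathbb{M}_{d,d'}$ be partitioned into $r$ blocks $A_k\in\mathbb{M}_{n_k,m_k}$, $k=1,\ldots,r$, and assume that the partitioning is row compatible or column compatible. Then, for all nonnegative integers $j_1,j_2,\ldots,j_r$, $$\mu^2_{j_1+j_2+\cdots+j_r+1}(\mathbb{A})\ \le\ \sum_{k=1}^{r}\mu^2_{j_k+1}(A_k).$$
   Context: $\mathbb{M}_{n,m}$ is the space of complex $n\times m$ matrices. For $S\in\mathbb{M}_{n,m}$, $\mu_1(S)\ge\mu_2(S)\ge\cdots$ are its singular values in nonincreasing order (with multiplicity), with the convention $\mu_k(S)=0$ for every $k>\min\{n,m\}$. A partitioning of $\mathbb{A}$ into blocks $A_1,\dots,A_r$ is a decomposition of the rectangular array of entries of $\mathbb{A}$ into pairwise disjoint nonempty rectangular blocks (submatrices formed by consecutive rows and consecutive columns) covering all entries; each $A_k$ is regarded both as an $n_k\times m_k$ matrix and as a submatrix with its position in $\mathbb{A}$. The partitioning is column compatible if for all $k,l$ either $A_k$ and $A_l$ lie on the same set of columns of $\mathbb{A}$ or they lie on disjoint sets of columns. It is row compatible if for all $k,l$ either $A_k$ and $A_l$ lie on the same set of rows of $\mathbb{A}$ or they lie on disjoint sets of rows. *)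

theory Defs
  imports
    "Jordan_Normal_Form.Schur_Decomposition"
    "Jordan_Normal_Form.DL_Submatrix"
begin

(* The eigenvalues of S* S are real and nonnegative, so taking Re loses nothing. The list has
   length dim_col S: char_poly is monic of that degree, and proots counts roots with multiplicity. *)
definition singular_values :: "complex mat \<Rightarrow> real list" where
  "singular_values S = rev (sorted_list_of_multiset
     (image_mset (\<lambda>z. sqrt (Re z)) (proots (char_poly (mat_adjoint S * S)))))"

(* Indexed from k = 1; the value at k = 0 is a dummy. *)
definition sv :: "complex mat \<Rightarrow> nat \<Rightarrow> real" where
  "sv S k = (if 1 \<le> k \<and> k \<le> min (dim_row S) (dim_col S)
     then singular_values S ! (k - 1) else 0)"

definition consecutive :: "nat \<Rightarrow> nat set \<Rightarrow> bool" where
  "consecutive d X \<longleftrightarrow> (\<exists>a b. a < b \<and> b \<le> d \<and> X = {a..<b})"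

(* Block k, for k in {1..r}, occupies the rows R k and the columns C k of a d x d' array;
   rows and columns are numbered from 0, as in the matrix library. *)
definition block_partitioning ::
  "nat \<Rightarrow> nat \<Rightarrow> nat \<Rightarrow> (nat \<Rightarrow> nat set) \<Rightarrow> (nat \<Rightarrow> nat set) \<Rightarrow> bool" where
  "block_partitioning d d' r R C \<longleftrightarrow>
     (\<forall>k\<in>{1..r}. consecutive d (R k) \<and> consecutive d' (C k)) \<and>
     (\<forall>k\<in>{1..r}. \<forall>l\<in>{1..r}. k \<noteq> l \<longrightarrow> (R k \<times> C k) \<inter> (R l \<times> C l) = {}) \<and>
     (\<Union>k\<in>{1..r}. R k \<times> C k) = {0..<d} \<times> {0..<d'}"

definition row_compatible :: "nat \<Rightarrow> (nat \<Rightarrow> nat set) \<Rightarrow> bool" where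
  "row_compatible r R \<longleftrightarrow> (\<forall>k\<in>{1..r}. \<forall>l\<in>{1..r}. R k = R l \<or> R k \<inter> R l = {})"

definition column_compatible :: "nat \<Rightarrow> (nat \<Rightarrow> nat set) \<Rightarrow> bool" where
  "column_compatible r C \<longleftrightarrow> (\<forall>k\<in>{1..r}. \<forall>l\<in>{1..r}. C k = C l \<or> C k \<inter> C l = {})"

end

theory Submission
  imports Defs "HOL-Computational_Algebra.Fundamental_Theorem_Algebra" "HOL-Analysis.L2_Norm"
begin

text \<open>
  The \<open>k + 1\<close>-st singular value of a matrix has a description that does not mention eigenvalues:
  for \<open>c \<ge> 0\<close>, its square is at most \<open>c\<close> exactly when \<open>\<parallel>S x\<parallel>\<^sup>2 \<le> c \<parallel>x\<parallel>\<^sup>2\<close> holds on some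
  subspace of codimension at most \<open>k\<close> (the min-max principle, lemmas \<open>sqnorm_le_codim_sv\<close> and
  \<open>sv_sq_le_if_sqnorm_le_codim\<close>). In this form the inequality becomes a statement about how such
  bounds combine. Take for each block a subspace of codimension \<open>j\<^sub>k\<close> on which its squared norm is
  at most \<open>c\<^sub>k\<close>, the square of its singular value with index \<open>j\<^sub>k + 1\<close>, and restrict to the vectors
  whose parts meet all these conditions; the codimensions add up to at most \<open>\<Sum>k. j\<^sub>k\<close>.

  The constants \<open>c\<^sub>k\<close> add up as well. If blocks on the same columns are stacked on top of each other
  (\<open>sqnorm_le_codim_stack_rows\<close>), the squared norms of the images add, by orthogonality. If blocks
  on the same rows are placed side by side (\<open>sqnorm_le_codim_concat_columns\<close>), the image is a sum
  of vectors of norm at most \<open>sqrt c\<^sub>k * \<parallel>x\<^sub>k\<parallel>\<close>, where \<open>x\<^sub>k\<close> is the part of \<open>x\<close> on the columns of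
  block \<open>k\<close>, and the inequalities of Minkowski and Cauchy-Schwarz give the constant \<open>\<Sum>k. c\<^sub>k\<close>.
  For a column compatible partitioning the matrix is a row of vertical strips, each of which is a
  stack of blocks, so stacking followed by concatenation reaches the whole matrix. For a row
  compatible partitioning the same two steps apply in the other order.

  The min-max principle needs a unitary diagonalization of \<open>S\<^sup>* S\<close> with the eigenvalues in
  decreasing order; \<open>hermitian_unitary_diagonalization\<close> provides it for any prescribed order.
\<close>

section \<open>Adjoint matrices\<close>

lemma dim_mat_adjoint [simp]: "dim_row (mat_adjoint A) = dim_col A" "dim_col (mat_adjoint A) = dim_row A"
  by (auto simp: mat_adjoint_def)

lemma mat_adjoint_carrier [simp]: "A \<in> carrier_mat n m \<Longrightarrow> mat_adjoint A \<in> carrier_mat m n"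
  by auto

lemma index_mat_adjoint [simp]:
  "i < dim_col A \<Longrightarrow> j < dim_row A \<Longrightarrow> mat_adjoint A $$ (i, j) = conjugate (A $$ (j, i))"
  by (auto simp: mat_adjoint_def mat_of_rows_def)

lemma mat_adjoint_mult:
  fixes A B :: "'a :: conjugatable_field mat"
  assumes "A \<in> carrier_mat n m" "B \<in> carrier_mat m p"
  shows "mat_adjoint (A * B) = mat_adjoint B * mat_adjoint A"
  using assms
  by (intro eq_matI)
    (auto simp: scalar_prod_def sum_conjugate conjugate_dist_mul mult.commute intro!: sum.cong)

lemma mat_adjoint_adjoint [simp]: "mat_adjoint (mat_adjoint A) = A"
  by (intro eq_matI) auto

lemma mat_adjoint_four_block_diag:
  fixes A B :: "'a :: conjugatable_field mat"
  assumes "A \<in> carrier_mat n n" "B \<in> carrier_mat m m"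
  shows "mat_adjoint (four_block_mat A (0\<^sub>m n m) (0\<^sub>m m n) B) =
    four_block_mat (mat_adjoint A) (0\<^sub>m n m) (0\<^sub>m m n) (mat_adjoint B)"
  using assms by (intro eq_matI) auto

lemma four_block_diag_mult:
  fixes A B :: "'a :: comm_ring_1 mat"
  assumes "A \<in> carrier_mat n n" "B \<in> carrier_mat m m" "C \<in> carrier_mat n n" "D \<in> carrier_mat m m"
  shows "four_block_mat A (0\<^sub>m n m) (0\<^sub>m m n) B * four_block_mat C (0\<^sub>m n m) (0\<^sub>m m n) D =
    four_block_mat (A * C) (0\<^sub>m n m) (0\<^sub>m m n) (B * D)"
  using assms by (subst mult_four_block_mat[where ?nc1.0 = n and ?nc2.0 = m]) (auto)

section \<open>Unitary diagonalization of Hermitian matrices\<close>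

lemma vec_inv_unit:
  assumes "w \<bullet>c w = 1" shows "vec_inv w = conjugate w"
  using assms by (simp add: vec_inv_def)

text \<open>
  Gram-Schmidt orthogonalization of a basis that begins with \<open>v\<close> keeps \<open>v\<close> as its first vector, and
  scaling the resulting vectors to length \<open>1\<close> changes \<open>v\<close> only by a factor.
\<close>

lemma orthonormal_basis_with_hd:
  fixes v :: "complex vec"
  assumes v: "v \<in> carrier_vec n" "v \<noteq> 0\<^sub>v n"
  obtains ws a where "set ws \<subseteq> carrier_vec n" "corthogonal ws" "length ws = n"
    "hd ws = a \<cdot>\<^sub>v v" "a \<noteq> 0" "\<And>w. w \<in> set ws \<Longrightarrow> w \<bullet>c w = 1"
proof -
  interpret cof_vec_space n "TYPE(complex)" .
  define b where "b = basis_completion v"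
  from basis_completion[OF v, folded b_def]
  have dist: "distinct b" and indep: "\<not> lin_dep (set b)" and b: "set b \<subseteq> carrier_vec n"
    and hdb: "hd b = v" and len: "length b = n"
    by auto
  have n: "n \<noteq> 0" using v by (metis eq_vecI less_nat_zero_code carrier_vecD zero_carrier_vec)
  from hdb len n obtain vs where bv: "b = v # vs" by (cases b) auto
  define us where "us = gram_schmidt n b"
  from gram_schmidt_result[OF b dist indep refl, folded us_def]
  have us: "set us \<subseteq> carrier_vec n" "corthogonal us" "length us = n"
    by (auto simp: len)
  from gram_schmidt_hd[OF v(1), of vs, folded bv] have hdus: "hd us = v"
    unfolding us_def .
  define s where "s w = complex_of_real (1 / sqrt (Re (w \<bullet>c w)))" for w :: "complex vec"
  define ws where "ws = map (\<lambda>w. s w \<cdot>\<^sub>v w) us"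
  have pos: "w \<bullet>c w > 0" if "w \<in> set us" for w
  proof -
    have "w \<in> carrier_vec n" using us that by auto
    moreover have "w \<bullet>c w \<noteq> 0"
      using corthogonalD[OF us(2)] that by (metis in_set_conv_nth)
    ultimately show ?thesis by auto
  qed
  have s0: "s w \<noteq> 0" if "w \<in> set us" for w
    using pos[OF that] by (auto simp: s_def less_complex_def)
  have unit: "(s w \<cdot>\<^sub>v w) \<bullet>c (s w \<cdot>\<^sub>v w) = 1" if "w \<in> set us" for w
  proof -
    have w: "w \<in> carrier_vec n" using us that by auto
    define q where "q = Re (w \<bullet>c w)"
    have q: "q > 0" "w \<bullet>c w = of_real q"
      using pos[OF that] by (auto simp: q_def less_complex_def complex_eq_iff)
    have "(s w \<cdot>\<^sub>v w) \<bullet>c (s w \<cdot>\<^sub>v w) = s w * cnj (s w) * (w \<bullet>c w)"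
      using w by (simp add: conjugate_smult_vec)
    also have "\<dots> = 1"
    proof -
      have "s w * cnj (s w) = complex_of_real (1 / q)"
        using q(1) by (simp add: s_def q_def[symmetric] flip: of_real_mult of_real_divide)
      then show ?thesis using q by simp
    qed
    finally show ?thesis .
  qed
  show ?thesis
  proof
    show "set ws \<subseteq> carrier_vec n" "length ws = n" using us by (auto simp: ws_def)
    show "corthogonal ws"
    proof (rule corthogonalI)
      fix i j assume ij: "i < length ws" "j < length ws"
      have c: "us ! i \<in> carrier_vec n" "us ! j \<in> carrier_vec n" using us ij by (auto simp: ws_def)
      have "ws ! i \<bullet>c ws ! j = s (us ! i) * cnj (s (us ! j)) * (us ! i \<bullet>c us ! j)"
        using c ij by (simp add: ws_def conjugate_smult_vec)
      then show "(ws ! i \<bullet>c ws ! j = 0) = (i \<noteq> j)"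
        using ij s0 corthogonalD[OF us(2)] by (auto simp: ws_def)
    qed
    have "us \<noteq> []" using us n by auto
    then show "hd ws = s v \<cdot>\<^sub>v v" "s v \<noteq> 0" using hdus s0 by (auto simp: ws_def hd_map)
    show "\<And>w. w \<in> set ws \<Longrightarrow> w \<bullet>c w = 1" using unit by (auto simp: ws_def)
  qed
qed

text \<open>
  The induction splits off one eigenvalue at a time. Conjugating \<open>H\<close> by a unitary \<open>W\<close> whose first
  column is an eigenvector for \<open>e\<close> clears the first column below the diagonal; since the result is
  again Hermitian, the first row is cleared too, and what remains is a Hermitian matrix of size
  \<open>n - 1\<close> whose characteristic polynomial has the remaining roots. The list \<open>es\<close> may be any
  enumeration of the roots, which later allows to have the singular values in decreasing order.
\<close>

lemma hermitian_unitary_diagonalization: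
  fixes H :: "complex mat"
  assumes "H \<in> carrier_mat n n" "mat_adjoint H = H" "char_poly H = (\<Prod>e\<leftarrow>es. [:- e, 1:])"
  shows "\<exists>U \<in> carrier_mat n n. mat_adjoint U * U = 1\<^sub>m n \<and>
    mat_adjoint U * H * U = mat n n (\<lambda>(i, j). if i = j then es ! i else 0)"
  using assms
proof (induction es arbitrary: n H)
  case Nil
  with degree_monic_char_poly[of H n] have "n = 0" by auto
  then show ?case by (intro bexI[of _ "1\<^sub>m 0"]) auto
next
  case (Cons e es n H)
  note H = Cons.prems(1)
  have cp: "char_poly H = [:- e, 1:] * (\<Prod>e\<leftarrow>es. [:- e, 1:])" using Cons.prems by simp
  have "eigenvalue H e" unfolding eigenvalue_root_char_poly[OF H] cp by simp
  then obtain v where v: "v \<in> carrier_vec n" "v \<noteq> 0\<^sub>v n" and ev: "H *\<^sub>v v = e \<cdot>\<^sub>v v"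
    using H by (auto simp: eigenvalue_def eigenvector_def)
  have n: "n \<noteq> 0" using v by (metis eq_vecI less_nat_zero_code carrier_vecD zero_carrier_vec)
  then obtain m where m: "n = Suc m" by (cases n) auto
  obtain ws a where ws: "set ws \<subseteq> carrier_vec n" "corthogonal ws" "length ws = n"
    "hd ws = a \<cdot>\<^sub>v v" "a \<noteq> 0" "\<And>w. w \<in> set ws \<Longrightarrow> w \<bullet>c w = 1"
    using orthonormal_basis_with_hd[OF v] by metis
  define W where "W = mat_of_cols n ws"
  have W: "W \<in> carrier_mat n n" unfolding W_def using ws by auto
  \<comment> \<open>The vectors \<open>ws\<close> have length \<open>1\<close>, so inverting a matrix with these orthogonal columns takes
    no rescaling of the conjugated columns.\<close>
  have adjW: "corthogonal_inv W = mat_adjoint W"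
  proof -
    have "map vec_inv (cols W) = map conjugate (cols W)"
      using ws by (auto simp: W_def vec_inv_unit)
    then show ?thesis unfolding corthogonal_inv_def mat_adjoint_def by (rule arg_cong)
  qed
  have WW: "mat_adjoint W * W = 1\<^sub>m n"
    using corthogonal_inv_result[OF orthogonal_mat_of_cols[OF ws(1,2,3)]] W
    unfolding adjW[unfolded W_def] inverts_mat_def W_def by (simp add: ws(3))
  have WW': "W * mat_adjoint W = 1\<^sub>m n"
    using mat_mult_left_right_inverse[OF _ W WW] W by simp
  define H' where "H' = mat_adjoint W * H * W"
  have H': "H' \<in> carrier_mat n n" using W H by (auto simp: H'_def)
  have adjH': "mat_adjoint H' = H'"
    unfolding H'_def using W H Cons.prems(2)
    by (simp add: mat_adjoint_mult[of _ n n _ n] assoc_mult_mat[of _ n n _ n _ n])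
  have "H *\<^sub>v (a \<cdot>\<^sub>v v) = e \<cdot>\<^sub>v (a \<cdot>\<^sub>v v)"
    using v ev H by (simp add: mult_mat_vec[of _ n n] smult_smult_assoc mult.commute)
  moreover have "a \<cdot>\<^sub>v v \<noteq> 0\<^sub>v n"
  proof
    assume z: "a \<cdot>\<^sub>v v = 0\<^sub>v n"
    have "v $ i = 0" if "i < n" for i
      using arg_cong[OF z, of "\<lambda>u. u $ i"] that v(1) ws(5) by simp
    then show False using v by (auto intro: eq_vecI)
  qed
  ultimately have col0: "col H' 0 = vec n (\<lambda>i. if i = 0 then e else 0)"
    using corthogonal_col_ev_0[OF H _ _ _ n ws(4) ws(1-3), of e] v ws(5)
    by (auto simp: H'_def W_def[symmetric] adjW)
  have ci: "H' $$ (i, 0) = (if i = 0 then e else 0)" if "i < n" for i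
    using arg_cong[OF col0, of "\<lambda>u. u $ i"] that H' n by auto
  have ri: "H' $$ (0, i) = 0" if "i < n" "i \<noteq> 0" for i
    using arg_cong[OF adjH', of "\<lambda>M. M $$ (0, i)"] that ci[of i] H' n by auto
  define H3 where "H3 = mat m m (\<lambda>(i, j). H' $$ (Suc i, Suc j))"
  define E where "E = mat 1 1 (\<lambda>_. e)"
  have H3: "H3 \<in> carrier_mat m m" and E: "E \<in> carrier_mat 1 1" by (auto simp: H3_def E_def)
  have blk: "H' = four_block_mat E (0\<^sub>m 1 m) (0\<^sub>m m 1) H3"
    by (rule eq_matI) (use H' m ci ri in \<open>auto simp: H3_def E_def\<close>)
  have adjH3: "mat_adjoint H3 = H3"
  proof (rule eq_matI)
    fix i j assume "i < dim_row H3" "j < dim_col H3"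
    then show "mat_adjoint H3 $$ (i, j) = H3 $$ (i, j)"
      using arg_cong[OF adjH', of "\<lambda>M. M $$ (Suc i, Suc j)"] H' m by (auto simp: H3_def)
  qed (auto simp: H3_def)
  have "similar_mat_wit H' H (mat_adjoint W) W"
    by (rule similar_mat_witI[of _ _ n]) (use W H H' WW WW' in \<open>auto simp: H'_def\<close>)
  then have "char_poly H' = char_poly H"
    by (intro char_poly_similar) (auto simp: similar_mat_def)
  moreover have "char_poly H' = char_poly E * char_poly H3"
    unfolding blk by (rule char_poly_four_block_zeros_col[OF E _ H3]) simp
  moreover have "char_poly E = [:- e, 1:]"
    by (simp add: E_def char_poly_defs det_def sign_def)
  ultimately have "char_poly H3 = (\<Prod>e\<leftarrow>es. [:- e, 1:])"
    using cp by (metis mult_cancel_left pCons_eq_0_iff zero_neq_one)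
  from Cons.IH[OF H3 adjH3 this] obtain U where U: "U \<in> carrier_mat m m"
    and UU: "mat_adjoint U * U = 1\<^sub>m m"
    and UH: "mat_adjoint U * H3 * U = mat m m (\<lambda>(i, j). if i = j then es ! i else 0)"
    by auto
  define V where "V = four_block_mat (1\<^sub>m 1) (0\<^sub>m 1 m) (0\<^sub>m m 1) U"
  have V: "V \<in> carrier_mat n n" unfolding V_def m using U by auto
  have adj1: "mat_adjoint (1\<^sub>m 1) = (1\<^sub>m 1 :: complex mat)" by (intro eq_matI) auto
  have adjV: "mat_adjoint V = four_block_mat (1\<^sub>m 1) (0\<^sub>m 1 m) (0\<^sub>m m 1) (mat_adjoint U)"
    unfolding V_def using mat_adjoint_four_block_diag[of "1\<^sub>m 1" 1 U m] U adj1 by simp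
  have VV: "mat_adjoint V * V = 1\<^sub>m n"
    unfolding adjV unfolding V_def using U
    by (subst four_block_diag_mult[where n = 1 and m = m]) (auto simp: UU m)
  have VHV: "mat_adjoint V * H' * V = mat n n (\<lambda>(i, j). if i = j then (e # es) ! i else 0)"
  proof -
    have "mat_adjoint V * H' * V =
      four_block_mat (1\<^sub>m 1 * E * 1\<^sub>m 1) (0\<^sub>m 1 m) (0\<^sub>m m 1) (mat_adjoint U * H3 * U)"
      unfolding adjV unfolding V_def blk using U E H3
      by (subst four_block_diag_mult[where n = 1 and m = m];
          (subst four_block_diag_mult[where n = 1 and m = m])?) auto
    also have "\<dots> = mat n n (\<lambda>(i, j). if i = j then (e # es) ! i else 0)"
      unfolding UH by (rule eq_matI) (use E in \<open>auto simp: m E_def nth_Cons'\<close>)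
    finally show ?thesis .
  qed
  show ?case
  proof (intro bexI conjI)
    show "W * V \<in> carrier_mat n n" using W V by auto
    have "mat_adjoint W * (W * V) = mat_adjoint W * W * V"
      using W V by (simp add: assoc_mult_mat[of _ n n _ n _ n])
    also have "\<dots> = V" using V WW by simp
    finally have "mat_adjoint W * (W * V) = V" .
    then have "mat_adjoint (W * V) * (W * V) = mat_adjoint V * V"
      using W V by (simp add: mat_adjoint_mult[of _ n n _ n] assoc_mult_mat[of _ n n _ n _ n])
    then show "mat_adjoint (W * V) * (W * V) = 1\<^sub>m n" using VV by simp
    have "mat_adjoint (W * V) * H * (W * V) = mat_adjoint V * H' * V"
      using W V H unfolding H'_def
      by (simp add: mat_adjoint_mult[of _ n n _ n] assoc_mult_mat[of _ n n _ n _ n]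
          mult_carrier_mat[of _ n n _ n])
    then show "mat_adjoint (W * V) * H * (W * V) =
      mat n n (\<lambda>(i, j). if i = j then (e # es) ! i else 0)" using VHV by simp
  qed
qed

section \<open>Norm bounds on subspaces of bounded codimension\<close>

definition sqnorm_on :: "nat set \<Rightarrow> (nat \<Rightarrow> complex) \<Rightarrow> real" where
  "sqnorm_on I x = (\<Sum>i\<in>I. (cmod (x i))\<^sup>2)"

text \<open>
  The operator is the block of the matrix \<open>a\<close> in the rows \<open>I\<close> and the columns \<open>J\<close>, and each \<open>w \<in> F\<close> stands for the linear functional \<open>x \<mapsto> \<Sum>j\<in>J. w j * x j\<close>. Vectors are
  functions on all natural numbers and blocks are given by index sets, so a block and the matrix
  that contains it share the same entries and the same vectors, and no restriction or embedding
  maps appear when blocks are combined.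
\<close>

definition sqnorm_le_on_annihilator ::
  "(nat \<Rightarrow> nat \<Rightarrow> complex) \<Rightarrow> nat set \<Rightarrow> nat set \<Rightarrow> (nat \<Rightarrow> complex) set \<Rightarrow> real \<Rightarrow> bool" where
  "sqnorm_le_on_annihilator a I J F c \<longleftrightarrow>
     (\<forall>x. (\<forall>w\<in>F. (\<Sum>j\<in>J. w j * x j) = 0) \<longrightarrow>
       sqnorm_on I (\<lambda>i. \<Sum>j\<in>J. a i j * x j) \<le> c * sqnorm_on J x)"

text \<open>
  A subspace has codimension at most \<open>k\<close> exactly if it is the common kernel of at most \<open>k\<close> functionals.
  Describing it by functionals makes codimensions easy to add: intersecting subspaces means
  taking the union of the sets of functionals.
\<close>

definition sqnorm_le_codim ::
  "(nat \<Rightarrow> nat \<Rightarrow> complex) \<Rightarrow> nat set \<Rightarrow> nat set \<Rightarrow> nat \<Rightarrow> real \<Rightarrow> bool" where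
  "sqnorm_le_codim a I J k c \<longleftrightarrow>
     (\<exists>F. finite F \<and> card F \<le> k \<and> sqnorm_le_on_annihilator a I J F c)"

lemma sqnorm_le_codimI:
  assumes "finite F" "card F \<le> k"
    and "\<And>x. (\<And>w. w \<in> F \<Longrightarrow> (\<Sum>j\<in>J. w j * x j) = 0) \<Longrightarrow>
      sqnorm_on I (\<lambda>i. \<Sum>j\<in>J. a i j * x j) \<le> c * sqnorm_on J x"
  shows "sqnorm_le_codim a I J k c"
  unfolding sqnorm_le_codim_def sqnorm_le_on_annihilator_def using assms by blast

lemma sqnorm_le_on_annihilatorD:
  assumes "sqnorm_le_on_annihilator a I J F c"
    and "\<And>w. w \<in> F \<Longrightarrow> (\<Sum>j\<in>J. w j * x j) = 0"
  shows "sqnorm_on I (\<lambda>i. \<Sum>j\<in>J. a i j * x j) \<le> c * sqnorm_on J x"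
  using assms unfolding sqnorm_le_on_annihilator_def by blast

lemma sqnorm_on_nonneg [simp]: "0 \<le> sqnorm_on I x"
  by (simp add: sqnorm_on_def sum_nonneg)

section \<open>The min-max principle for singular values\<close>

lemma cscalar_prod_self:
  fixes v :: "complex vec"
  assumes "v \<in> carrier_vec n"
  shows "v \<bullet>c v = of_real (sqnorm_on {..<n} (($) v))"
  using assms
  by (auto simp: scalar_prod_def sqnorm_on_def lessThan_atLeast0 complex_mult_cnj cmod_power2 intro!: sum.cong)

lemma cscalar_prod_adjoint:
  fixes M :: "complex mat"
  assumes "M \<in> carrier_mat n m" "x \<in> carrier_vec m" "y \<in> carrier_vec n"
  shows "(M *\<^sub>v x) \<bullet>c y = x \<bullet>c (mat_adjoint M *\<^sub>v y)"
proof -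
  have "(M *\<^sub>v x) \<bullet>c y = (\<Sum>i<n. \<Sum>j<m. M $$ (i, j) * x $ j * cnj (y $ i))"
    using assms by (auto simp: scalar_prod_def lessThan_atLeast0 sum_distrib_right intro!: sum.cong)
  also have "\<dots> = (\<Sum>j<m. \<Sum>i<n. M $$ (i, j) * x $ j * cnj (y $ i))"
    by (rule sum.swap)
  also have "\<dots> = x \<bullet>c (mat_adjoint M *\<^sub>v y)"
    using assms by (auto simp: scalar_prod_def lessThan_atLeast0 sum_distrib_left ac_simps intro!: sum.cong)
  finally show ?thesis .
qed

text \<open>
  The singular values are defined by sorting real numbers, whereas the diagonalization refers to
  complex roots. Sorting the roots by the key \<open>sqrt (Re z)\<close> gives one list that serves both.
\<close>

lemma singular_values_from_eigenvalues:
  fixes S :: "complex mat"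
  assumes "S \<in> carrier_mat n m"
  obtains es where "char_poly (mat_adjoint S * S) = (\<Prod>e\<leftarrow>es. [:- e, 1:])"
    "singular_values S = map (\<lambda>z. sqrt (Re z)) es" "length es = m"
proof -
  let ?p = "char_poly (mat_adjoint S * S)" and ?f = "\<lambda>z. sqrt (Re z)"
  have G: "mat_adjoint S * S \<in> carrier_mat m m" using assms by auto
  obtain es0 where es0: "mset es0 = proots ?p" using ex_mset by blast
  define es where "es = rev (sort_key ?f es0)"
  have mset: "mset es = proots ?p" using es0 by (simp add: es_def)
  have "?p = smult (lead_coeff ?p) (\<Prod>x\<in>#proots ?p. [:-x, 1:])"
    by (rule complex_poly_decompose_multiset[symmetric])
  also have "lead_coeff ?p = 1" using degree_monic_char_poly[OF G] by simp
  also have "(\<Prod>x\<in>#proots ?p. [:-x, 1:]) = (\<Prod>e\<leftarrow>es. [:- e, 1:])"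
    by (simp flip: mset prod_mset_prod_list)
  finally have 1: "?p = (\<Prod>e\<leftarrow>es. [:- e, 1:])" by simp
  have "sorted_list_of_multiset (image_mset ?f (proots ?p)) = map ?f (sort_key ?f es0)"
  proof -
    have "sorted_list_of_multiset (image_mset ?f (proots ?p)) = sort (map ?f (sort_key ?f es0))"
      by (metis es0 mset_map mset_sort sorted_list_of_multiset_mset)
    then show ?thesis by (simp add: sorted_sort_id)
  qed
  then have 2: "singular_values S = map ?f es"
    by (simp add: singular_values_def es_def rev_map)
  have "size (proots ?p) = m"
    using degree_monic_char_poly[OF G] by (simp add: size_proots_complex)
  then have 3: "length es = m" by (metis mset size_mset)
  show ?thesis using 1 2 3 by (rule that)
qed

lemma singular_values_antimono:
  assumes "S \<in> carrier_mat n m" "i \<le> j" "j < m"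
  shows "singular_values S ! j \<le> singular_values S ! i"
proof -
  have "length (singular_values S) = m"
    using singular_values_from_eigenvalues[OF assms(1)] by (metis length_map)
  moreover have "sorted_wrt (\<ge>) (singular_values S)"
    unfolding singular_values_def sorted_wrt_rev by simp
  ultimately show ?thesis
    using assms by (cases "i = j") (auto simp: sorted_wrt_iff_nth_less)
qed

text \<open>
  The columns of \<open>U\<close> are an orthonormal basis of right singular vectors, in the order of the
  singular values, and \<open>y\<close> is the vector of coordinates with respect to that basis. The last
  conjunct is the form in which \<open>S\<^sup>* S = U D U\<^sup>*\<close> enters the min-max principle.
\<close>

definition right_singular_basis :: "complex mat \<Rightarrow> complex mat \<Rightarrow> bool" where
  "right_singular_basis S U \<longleftrightarrow>
     U \<in> carrier_mat (dim_col S) (dim_col S) \<and> mat_adjoint U * U = 1\<^sub>m (dim_col S) \<and>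
     (\<forall>y \<in> carrier_vec (dim_col S).
       sqnorm_on {..<dim_row S} (($) (S *\<^sub>v (U *\<^sub>v y))) =
         (\<Sum>i<dim_col S. (singular_values S ! i)\<^sup>2 * (cmod (y $ i))\<^sup>2))"

lemma sqnorm_on_unitary:
  fixes U :: "complex mat"
  assumes U: "U \<in> carrier_mat m m" "mat_adjoint U * U = 1\<^sub>m m" and y: "y \<in> carrier_vec m"
  shows "sqnorm_on {..<m} (($) (U *\<^sub>v y)) = sqnorm_on {..<m} (($) y)"
proof -
  have "mat_adjoint U *\<^sub>v (U *\<^sub>v y) = mat_adjoint U * U *\<^sub>v y"
    using U y by (subst assoc_mult_mat_vec[of _ m m _ m]) auto
  then have "(U *\<^sub>v y) \<bullet>c (U *\<^sub>v y) = y \<bullet>c y"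
    using U y by (subst cscalar_prod_adjoint[of _ m m]) auto
  then show ?thesis using U y by (simp add: cscalar_prod_self[of _ m])
qed

text \<open>
  For \<open>x = U y\<close>, the identity \<open>\<parallel>S x\<parallel>\<^sup>2 = \<langle>x, S\<^sup>* S x\<rangle> = \<langle>y, D y\<rangle>\<close> turns the squared norm into a
  sum weighted by the eigenvalues of \<open>S\<^sup>* S\<close>. Applied to the unit vectors \<open>y\<close>, it also shows that
  these eigenvalues are real and nonnegative, so that \<open>sqrt (Re z)\<close> squares back to \<open>z\<close>.
\<close>

lemma right_singular_basis_exists:
  fixes S :: "complex mat"
  assumes S: "S \<in> carrier_mat n m"
  shows "\<exists>U. right_singular_basis S U" and "\<And>i. i < m \<Longrightarrow> 0 \<le> singular_values S ! i"
proof -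
  define G where "G = mat_adjoint S * S"
  have G: "G \<in> carrier_mat m m" using S by (auto simp: G_def)
  have adjG: "mat_adjoint G = G" using S by (simp add: G_def mat_adjoint_mult[of _ m n _ m])
  obtain es where cp: "char_poly G = (\<Prod>e\<leftarrow>es. [:- e, 1:])"
    and sv: "singular_values S = map (\<lambda>z. sqrt (Re z)) es" and len: "length es = m"
    using singular_values_from_eigenvalues[OF S] unfolding G_def by metis
  obtain U where U: "U \<in> carrier_mat m m" "mat_adjoint U * U = 1\<^sub>m m"
    and D: "mat_adjoint U * G * U = mat m m (\<lambda>(i, j). if i = j then es ! i else 0)"
    using hermitian_unitary_diagonalization[OF G adjG cp] by auto
  have norm_S: "of_real (sqnorm_on {..<n} (($) (S *\<^sub>v (U *\<^sub>v y)))) =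
      (\<Sum>i<m. cnj (es ! i) * of_real ((cmod (y $ i))\<^sup>2))"
    if y: "y \<in> carrier_vec m" for y
  proof -
    let ?x = "U *\<^sub>v y"
    have x: "?x \<in> carrier_vec m" using U y by auto
    have "of_real (sqnorm_on {..<n} (($) (S *\<^sub>v ?x))) = (S *\<^sub>v ?x) \<bullet>c (S *\<^sub>v ?x)"
      using S x by (simp add: cscalar_prod_self[of _ n])
    also have "\<dots> = ?x \<bullet>c (mat_adjoint S *\<^sub>v (S *\<^sub>v ?x))"
      using S x by (subst cscalar_prod_adjoint[of _ n m]) auto
    also have "\<dots> = ?x \<bullet>c (G *\<^sub>v ?x)"
      unfolding G_def using S x by (subst assoc_mult_mat_vec[of _ m n _ m]) auto
    also have "\<dots> = y \<bullet>c (mat_adjoint U *\<^sub>v (G *\<^sub>v ?x))"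
      using U G x y by (subst cscalar_prod_adjoint[of _ m m]) auto
    also have "\<dots> = y \<bullet>c (mat_adjoint U * G * U *\<^sub>v y)"
      using U G y by (simp add: assoc_mult_mat_vec[of _ m m _ m] assoc_mult_mat[of _ m m _ m _ m]
          mult_carrier_mat[of _ m m _ m])
    also have "\<dots> = (\<Sum>i<m. y $ i * cnj (es ! i * y $ i))"
    proof -
      have "(mat_adjoint U * G * U *\<^sub>v y) $ i = es ! i * y $ i" if "i < m" for i
        unfolding D using that y
        by (auto simp: scalar_prod_def if_distrib[of "\<lambda>t. t * _"] sum.delta cong: if_cong)
      then show ?thesis using U G y by (auto simp: scalar_prod_def lessThan_atLeast0 intro!: sum.cong)
    qed
    also have "\<dots> = (\<Sum>i<m. cnj (es ! i) * of_real ((cmod (y $ i))\<^sup>2))"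
      by (intro sum.cong refl) (simp add: complex_mult_cnj cmod_power2 mult.left_commute)
    finally show ?thesis .
  qed
  have eig: "es ! i = of_real (Re (es ! i)) \<and> 0 \<le> Re (es ! i)" if i: "i < m" for i
  proof -
    have "cnj (es ! i) = of_real (sqnorm_on {..<n} (($) (S *\<^sub>v (U *\<^sub>v unit_vec m i))))"
    proof -
      have "(\<Sum>l<m. cnj (es ! l) * of_real ((cmod (unit_vec m i $ l))\<^sup>2)) =
          (\<Sum>l<m. if l = i then cnj (es ! i) else 0)"
        using i by (intro sum.cong) auto
      then show ?thesis using i by (simp add: norm_S)
    qed
    then have "es ! i = of_real (sqnorm_on {..<n} (($) (S *\<^sub>v (U *\<^sub>v unit_vec m i))))"
      by (metis complex_cnj_cnj complex_cnj_complex_of_real)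
    then show ?thesis by (metis Re_complex_of_real sqnorm_on_nonneg)
  qed
  have norm_SU: "sqnorm_on {..<n} (($) (S *\<^sub>v (U *\<^sub>v y))) =
      (\<Sum>i<m. (singular_values S ! i)\<^sup>2 * (cmod (y $ i))\<^sup>2)" if y: "y \<in> carrier_vec m" for y
  proof -
    have "cnj (es ! i) * of_real ((cmod (y $ i))\<^sup>2) =
        of_real ((singular_values S ! i)\<^sup>2 * (cmod (y $ i))\<^sup>2)" if i: "i < m" for i
    proof -
      have "cnj (es ! i) = es ! i" using eig[OF i] by (metis complex_cnj_complex_of_real)
      also have "es ! i = of_real ((singular_values S ! i)\<^sup>2)"
        using eig[OF i] i len by (simp add: sv)
      finally show ?thesis by simp
    qed
    then have "complex_of_real (sqnorm_on {..<n} (($) (S *\<^sub>v (U *\<^sub>v y)))) =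
      of_real (\<Sum>i<m. (singular_values S ! i)\<^sup>2 * (cmod (y $ i))\<^sup>2)"
      unfolding norm_S[OF y] of_real_sum by (intro sum.cong) auto
    then show ?thesis by (simp only: of_real_eq_iff)
  qed
  show "0 \<le> singular_values S ! i" if "i < m" for i using eig len that by (simp add: sv)
  show "\<exists>U. right_singular_basis S U"
    using S U norm_SU unfolding right_singular_basis_def by auto
qed

lemma sqnorm_on_mult_mat_vec:
  fixes S :: "complex mat"
  assumes "S \<in> carrier_mat n m"
  shows "sqnorm_on {..<n} (\<lambda>i. \<Sum>j<m. S $$ (i, j) * x j) = sqnorm_on {..<n} (($) (S *\<^sub>v vec m x))"
  using assms by (auto simp: sqnorm_on_def scalar_prod_def lessThan_atLeast0 intro!: sum.cong)

text \<open>
  On the orthogonal complement of the first \<open>k\<close> right singular vectors only the singular values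
  from the \<open>k + 1\<close>-st on contribute. When \<open>k\<close> reaches one of the dimensions, \<open>sv\<close> is \<open>0\<close> by
  convention, and a subspace of codimension at most \<open>k\<close> on which \<open>S\<close> vanishes is required: the
  zero space if \<open>m \<le> k\<close>, and the kernel of \<open>S\<close>, cut out by its \<open>n\<close> rows, if \<open>n \<le> k\<close>.
\<close>

lemma sqnorm_le_codim_sv:
  fixes S :: "complex mat"
  assumes S: "S \<in> carrier_mat n m"
  shows "sqnorm_le_codim (\<lambda>i j. S $$ (i, j)) {..<n} {..<m} k ((sv S (k + 1))\<^sup>2)"
proof -
  consider "m \<le> k" | "n \<le> k" | "k < n" "k < m" by linarith
  then show ?thesis
  proof cases
    case 1
    let ?F = "(\<lambda>i j. if j = i then 1 else 0 :: complex) ` {..<m}"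
    have "card ?F \<le> k" using card_image_le[of "{..<m}"] 1 by (metis card_lessThan finite_lessThan order_trans)
    moreover have "sqnorm_on {..<n} (\<lambda>i. \<Sum>j<m. S $$ (i, j) * x j) \<le> (sv S (k + 1))\<^sup>2 * sqnorm_on {..<m} x"
      if "\<forall>w\<in>?F. (\<Sum>j<m. w j * x j) = 0" for x
    proof -
      have "x i = 0" if "i < m" for i
        using \<open>\<forall>w\<in>?F. _\<close> that by (auto simp: if_distrib[of "\<lambda>t. t * _"] sum.delta cong: if_cong)
      then show ?thesis by (simp add: sqnorm_on_def sum_nonneg)
    qed
    ultimately show ?thesis by (intro sqnorm_le_codimI[of ?F]) auto
  next
    case 2
    let ?F = "(\<lambda>i j. S $$ (i, j)) ` {..<n}"
    have "card ?F \<le> k" using card_image_le[of "{..<n}"] 2 by (metis card_lessThan finite_lessThan order_trans)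
    moreover have "sqnorm_on {..<n} (\<lambda>i. \<Sum>j<m. S $$ (i, j) * x j) \<le> (sv S (k + 1))\<^sup>2 * sqnorm_on {..<m} x"
      if "\<forall>w\<in>?F. (\<Sum>j<m. w j * x j) = 0" for x
      using that by (simp add: sqnorm_on_def sum_nonneg)
    ultimately show ?thesis by (intro sqnorm_le_codimI[of ?F]) auto
  next
    case 3
    obtain U where "right_singular_basis S U" using right_singular_basis_exists(1)[OF S] by blast
    then have U: "U \<in> carrier_mat m m" "mat_adjoint U * U = 1\<^sub>m m"
      and nS: "\<And>y. y \<in> carrier_vec m \<Longrightarrow> sqnorm_on {..<n} (($) (S *\<^sub>v (U *\<^sub>v y))) =
        (\<Sum>i<m. (singular_values S ! i)\<^sup>2 * (cmod (y $ i))\<^sup>2)"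
      using S by (auto simp: right_singular_basis_def)
    note nU = sqnorm_on_unitary[OF U]
    note pos = right_singular_basis_exists(2)[OF S]
    have UU: "U * mat_adjoint U = 1\<^sub>m m"
      using mat_mult_left_right_inverse[OF _ U(1) U(2)] U by simp
    let ?F = "(\<lambda>i j. cnj (U $$ (j, i))) ` {..<k}"
    have "card ?F \<le> k" using card_image_le[of "{..<k}"] by (metis card_lessThan finite_lessThan)
    moreover have "sqnorm_on {..<n} (\<lambda>i. \<Sum>j<m. S $$ (i, j) * x j) \<le> (sv S (k + 1))\<^sup>2 * sqnorm_on {..<m} x"
      if F: "\<forall>w\<in>?F. (\<Sum>j<m. w j * x j) = 0" for x
    proof -
      define y where "y = mat_adjoint U *\<^sub>v vec m x"
      have y: "y \<in> carrier_vec m" using U by (auto simp: y_def intro!: mult_mat_vec_carrier[of _ m m])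
      have "U *\<^sub>v y = U * mat_adjoint U *\<^sub>v vec m x"
        unfolding y_def using U by (subst assoc_mult_mat_vec[of _ m m _ m]) auto
      then have Uy: "U *\<^sub>v y = vec m x" using UU by simp
      have y0: "y $ i = 0" if "i < k" for i
        using F that 3 U by (auto simp: y_def scalar_prod_def lessThan_atLeast0)
      have sv: "sv S (k + 1) = singular_values S ! k" using S 3 by (auto simp: sv_def)
      have "sqnorm_on {..<n} (\<lambda>i. \<Sum>j<m. S $$ (i, j) * x j) =
          (\<Sum>i<m. (singular_values S ! i)\<^sup>2 * (cmod (y $ i))\<^sup>2)"
        unfolding sqnorm_on_mult_mat_vec[OF S] Uy[symmetric] using nS[OF y] .
      also have "\<dots> \<le> (\<Sum>i<m. (sv S (k + 1))\<^sup>2 * (cmod (y $ i))\<^sup>2)"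
      proof (rule sum_mono)
        fix i assume "i \<in> {..<m}"
        then show "(singular_values S ! i)\<^sup>2 * (cmod (y $ i))\<^sup>2 \<le> (sv S (k + 1))\<^sup>2 * (cmod (y $ i))\<^sup>2"
          using y0[of i] pos[of i] singular_values_antimono[OF S, of k i]
          by (cases "i < k") (auto simp: sv[simplified] intro!: mult_right_mono power_mono)
      qed
      also have "\<dots> = (sv S (k + 1))\<^sup>2 * sqnorm_on {..<m} (($) (U *\<^sub>v y))"
        unfolding nU[OF y] by (simp add: sqnorm_on_def sum_distrib_left)
      also have "sqnorm_on {..<m} (($) (U *\<^sub>v y)) = sqnorm_on {..<m} x"
        unfolding Uy by (simp add: sqnorm_on_def)
      finally show ?thesis .
    qed
    ultimately show ?thesis by (intro sqnorm_le_codimI[of ?F]) auto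
  qed
qed

text \<open>
  The span of the first \<open>k + 1\<close> right singular vectors meets every subspace of codimension at
  most \<open>k\<close> nontrivially, and on this span \<open>\<parallel>S x\<parallel>\<^sup>2\<close> is at least the square of the \<open>k + 1\<close>-st singular value
  times \<open>\<parallel>x\<parallel>\<^sup>2\<close>.
\<close>

lemma sv_sq_le_if_sqnorm_le_codim:
  fixes S :: "complex mat"
  assumes S: "S \<in> carrier_mat n m" and c: "0 \<le> c"
    and le: "sqnorm_le_codim (\<lambda>i j. S $$ (i, j)) {..<n} {..<m} k c"
  shows "(sv S (k + 1))\<^sup>2 \<le> c"
proof (cases "k < n \<and> k < m")
  case False
  then show ?thesis using S c by (auto simp: sv_def)
next
  case True
  then have k: "k < n" "k < m" by auto
  obtain U where "right_singular_basis S U" using right_singular_basis_exists(1)[OF S] by blast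
  then have U: "U \<in> carrier_mat m m" "mat_adjoint U * U = 1\<^sub>m m"
    and nS: "\<And>y. y \<in> carrier_vec m \<Longrightarrow> sqnorm_on {..<n} (($) (S *\<^sub>v (U *\<^sub>v y))) =
      (\<Sum>i<m. (singular_values S ! i)\<^sup>2 * (cmod (y $ i))\<^sup>2)"
    using S by (auto simp: right_singular_basis_def)
  note nU = sqnorm_on_unitary[OF U]
  note pos = right_singular_basis_exists(2)[OF S]
  obtain F where F: "finite F" "card F \<le> k"
    and "sqnorm_le_on_annihilator (\<lambda>i j. S $$ (i, j)) {..<n} {..<m} F c"
    using le unfolding sqnorm_le_codim_def by blast
  note bound = sqnorm_le_on_annihilatorD[OF this(3)]
  obtain ws where ws: "set ws = F" "length ws \<le> k"
    using F by (metis finite_distinct_list distinct_card)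
  \<comment> \<open>A square system for the coordinates \<open>y\<close> of a common vector: the first rows are the functionals
    in \<open>F\<close>, the rows below row \<open>k\<close> force \<open>y\<close> into the span of the first \<open>k + 1\<close> singular vectors.
    As there are at most \<open>k\<close> functionals, row \<open>k\<close> is zero, so the system is singular.\<close>
  define M where "M = mat m m (\<lambda>(i, j). if i < length ws then \<Sum>l<m. (ws ! i) l * U $$ (l, j)
    else if i \<le> k then 0 else if i = j then 1 else 0)"
  have M: "M \<in> carrier_mat m m" by (simp add: M_def)
  have "transpose_mat M *\<^sub>v unit_vec m k = 0\<^sub>v m"
    by (rule eq_vecI) (use k ws(2) in \<open>auto simp: M_def\<close>)
  moreover have "unit_vec m k \<noteq> (0\<^sub>v m :: complex vec)" using k by simp
  ultimately have "det (transpose_mat M) = 0"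
    using det_0_iff_vec_prod_zero[of "transpose_mat M" m] M by (metis transpose_carrier_mat unit_vec_carrier)
  then have "det M = 0" using det_transpose[OF M] by simp
  then obtain y where y: "y \<in> carrier_vec m" "y \<noteq> 0\<^sub>v m" "M *\<^sub>v y = 0\<^sub>v m"
    using det_0_iff_vec_prod_zero[OF M] by auto
  have My: "(\<Sum>j<m. M $$ (i, j) * y $ j) = 0" if "i < m" for i
    using arg_cong[OF y(3), of "\<lambda>u. u $ i"] that M y(1)
    by (simp add: scalar_prod_def lessThan_atLeast0)
  have y0: "y $ i = 0" if "k < i" "i < m" for i
    using My[of i] that ws(2)
    by (auto simp: M_def if_distrib[of "\<lambda>t. t * _"] sum.delta cong: if_cong)
  have "(\<Sum>l<m. w l * (U *\<^sub>v y) $ l) = 0" if w: "w \<in> F" for w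
  proof -
    obtain i where i: "i < length ws" "ws ! i = w" using w ws by (metis in_set_conv_nth)
    have "(\<Sum>l<m. w l * (U *\<^sub>v y) $ l) = (\<Sum>l<m. \<Sum>j<m. w l * U $$ (l, j) * y $ j)"
      using U y by (auto simp: scalar_prod_def lessThan_atLeast0 sum_distrib_left mult.assoc intro!: sum.cong)
    also have "\<dots> = (\<Sum>j<m. \<Sum>l<m. w l * U $$ (l, j) * y $ j)"
      by (rule sum.swap)
    also have "\<dots> = (\<Sum>j<m. M $$ (i, j) * y $ j)"
      using i ws(2) k by (auto simp: M_def sum_distrib_right intro!: sum.cong)
    also have "\<dots> = 0" using My i ws(2) k by auto
    finally show ?thesis .
  qed
  then have "sqnorm_on {..<n} (\<lambda>i. \<Sum>j<m. S $$ (i, j) * (U *\<^sub>v y) $ j) \<le>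
      c * sqnorm_on {..<m} (($) (U *\<^sub>v y))"
    by (intro bound) auto
  also have "vec m (($) (U *\<^sub>v y)) = U *\<^sub>v y" using U y by auto
  then have "sqnorm_on {..<n} (\<lambda>i. \<Sum>j<m. S $$ (i, j) * (U *\<^sub>v y) $ j) =
      (\<Sum>i<m. (singular_values S ! i)\<^sup>2 * (cmod (y $ i))\<^sup>2)"
    unfolding sqnorm_on_mult_mat_vec[OF S] using nS[OF y(1)] by simp
  finally have upper: "(\<Sum>i<m. (singular_values S ! i)\<^sup>2 * (cmod (y $ i))\<^sup>2) \<le> c * sqnorm_on {..<m} (($) y)"
    by (simp add: nU[OF y(1)])
  have "(sv S (k + 1))\<^sup>2 * sqnorm_on {..<m} (($) y) \<le> (\<Sum>i<m. (singular_values S ! i)\<^sup>2 * (cmod (y $ i))\<^sup>2)"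
    unfolding sqnorm_on_def sum_distrib_left
  proof (rule sum_mono)
    fix i assume "i \<in> {..<m}"
    then show "(sv S (k + 1))\<^sup>2 * (cmod (y $ i))\<^sup>2 \<le> (singular_values S ! i)\<^sup>2 * (cmod (y $ i))\<^sup>2"
      using y0[of i] pos[of k] singular_values_antimono[OF S, of i k] k S
      by (cases "k < i") (auto simp: sv_def intro!: mult_right_mono power_mono)
  qed
  with upper have "(sv S (k + 1))\<^sup>2 * sqnorm_on {..<m} (($) y) \<le> c * sqnorm_on {..<m} (($) y)" by simp
  moreover have "0 < sqnorm_on {..<m} (($) y)"
  proof -
    obtain i where "i < m" "y $ i \<noteq> 0" using y(1,2) by (metis eq_vecI carrier_vecD index_zero_vec)
    then show ?thesis unfolding sqnorm_on_def by (intro sum_pos2[of _ i]) auto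
  qed
  ultimately show ?thesis by simp
qed


section \<open>Submatrices as blocks\<close>

lemma bij_betw_pick:
  assumes "finite I"
  shows "bij_betw (pick I) {..<card I} I"
proof -
  have inj: "inj_on (pick I) {..<card I}"
    by (rule inj_onI) (metis card_pick_le lessThan_iff)
  moreover have "pick I ` {..<card I} \<subseteq> I" by (auto simp: pick_in_set_le)
  ultimately show ?thesis
    using assms by (metis bij_betw_def card_image card_lessThan card_subset_eq)
qed

lemma sum_pick:
  assumes "finite I"
  shows "(\<Sum>i<card I. f (pick I i)) = sum f I"
  by (rule sum.reindex_bij_betw[OF bij_betw_pick[OF assms]])

text \<open>
  A submatrix renumbers its rows and columns from \<open>0\<close>; this carries the bound for the submatrix,
  taken as a matrix on its own, back to the positions of the block. The functionals are
  transported along the inverse of \<open>pick J\<close>, which sends \<open>j\<close> to its rank in \<open>J\<close>.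
\<close>

lemma sqnorm_le_codim_submatrix:
  fixes A :: "complex mat"
  assumes A: "A \<in> carrier_mat d d'" and I: "I \<subseteq> {..<d}" and J: "J \<subseteq> {..<d'}"
  shows "sqnorm_le_codim (\<lambda>i j. A $$ (i, j)) I J k ((sv (submatrix A I J) (k + 1))\<^sup>2)"
proof -
  let ?B = "submatrix A I J"
  have fin: "finite I" "finite J" using I J finite_subset by auto
  have sub: "{i. i < d \<and> i \<in> I} = I" "{j. j < d' \<and> j \<in> J} = J" using I J by auto
  have B: "?B \<in> carrier_mat (card I) (card J)"
    using A by (auto simp: dim_submatrix sub intro!: carrier_matI)
  have idx: "?B $$ (i, j) = A $$ (pick I i, pick J j)" if "i < card I" "j < card J" for i j
    using that A by (intro submatrix_index) (auto simp: sub)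
  obtain F where F: "finite F" "card F \<le> k"
    and "sqnorm_le_on_annihilator (\<lambda>i j. ?B $$ (i, j)) {..<card I} {..<card J} F ((sv ?B (k + 1))\<^sup>2)"
    using sqnorm_le_codim_sv[OF B, of k] unfolding sqnorm_le_codim_def by blast
  note bound = sqnorm_le_on_annihilatorD[OF this(3)]
  define F' where "F' = (\<lambda>w j. w (card {a\<in>J. a < j})) ` F"
  have "finite F'" "card F' \<le> k"
    using F card_image_le[OF F(1)] order_trans by (auto simp: F'_def)
  moreover have "sqnorm_on I (\<lambda>i. \<Sum>j\<in>J. A $$ (i, j) * x j) \<le> (sv ?B (k + 1))\<^sup>2 * sqnorm_on J x"
    if x: "\<forall>w\<in>F'. (\<Sum>j\<in>J. w j * x j) = 0" for x
  proof -
    have "(\<Sum>j<card J. w j * x (pick J j)) = 0" if "w \<in> F" for w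
    proof -
      have "(\<Sum>j<card J. w j * x (pick J j)) =
          (\<Sum>j<card J. w (card {a\<in>J. a < pick J j}) * x (pick J j))"
        by (intro sum.cong) (auto simp: card_pick_le)
      also have "\<dots> = (\<Sum>j\<in>J. w (card {a\<in>J. a < j}) * x j)"
        by (rule sum_pick[OF fin(2)])
      finally show ?thesis using x that by (auto simp: F'_def)
    qed
    then have "sqnorm_on {..<card I} (\<lambda>i. \<Sum>j<card J. ?B $$ (i, j) * x (pick J j))
        \<le> (sv ?B (k + 1))\<^sup>2 * sqnorm_on {..<card J} (\<lambda>j. x (pick J j))"
      by (intro bound) auto
    moreover have "sqnorm_on {..<card J} (\<lambda>j. x (pick J j)) = sqnorm_on J x"
      unfolding sqnorm_on_def by (rule sum_pick[OF fin(2)])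
    moreover have "sqnorm_on {..<card I} (\<lambda>i. \<Sum>j<card J. ?B $$ (i, j) * x (pick J j)) =
        sqnorm_on {..<card I} (\<lambda>i. \<Sum>j\<in>J. A $$ (pick I i, j) * x j)"
      unfolding sqnorm_on_def
      by (intro sum.cong refl) (simp add: idx flip: sum_pick[OF fin(2)])
    moreover have "\<dots> = sqnorm_on I (\<lambda>i. \<Sum>j\<in>J. A $$ (i, j) * x j)"
      unfolding sqnorm_on_def by (rule sum_pick[OF fin(1)])
    ultimately show ?thesis by simp
  qed
  ultimately show ?thesis by (intro sqnorm_le_codimI[of F']) auto
qed

section \<open>Combining blocks\<close>

text \<open>
  All blocks act on the same vector \<open>x\<close>, and their images have disjoint supports, so
  the squared norms of the images add.
\<close>

lemma sqnorm_le_codim_stack_rows: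
  assumes K: "finite K" "\<And>k. k \<in> K \<Longrightarrow> finite (R k)"
    and disj: "\<And>k l. k \<in> K \<Longrightarrow> l \<in> K \<Longrightarrow> k \<noteq> l \<Longrightarrow> R k \<inter> R l = {}"
    and le: "\<And>k. k \<in> K \<Longrightarrow> sqnorm_le_codim a (R k) J (n k) (c k)"
  shows "sqnorm_le_codim a (\<Union>k\<in>K. R k) J (\<Sum>k\<in>K. n k) (\<Sum>k\<in>K. c k)"
proof -
  obtain F where F: "\<And>k. k \<in> K \<Longrightarrow> finite (F k)" "\<And>k. k \<in> K \<Longrightarrow> card (F k) \<le> n k"
    and F_bound: "\<And>k. k \<in> K \<Longrightarrow> sqnorm_le_on_annihilator a (R k) J (F k) (c k)"
    using le unfolding sqnorm_le_codim_def by metis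
  note bound = sqnorm_le_on_annihilatorD[OF F_bound]
  let ?F = "\<Union>k\<in>K. F k"
  have "finite ?F" using K F by auto
  moreover have "card ?F \<le> (\<Sum>k\<in>K. n k)"
    using card_UN_le[OF K(1), of F] sum_mono[of K "\<lambda>k. card (F k)" n] F(2) by force
  moreover have "sqnorm_on (\<Union>k\<in>K. R k) (\<lambda>i. \<Sum>j\<in>J. a i j * x j) \<le> (\<Sum>k\<in>K. c k) * sqnorm_on J x"
    if x: "\<forall>w\<in>?F. (\<Sum>j\<in>J. w j * x j) = 0" for x
  proof -
    have "sqnorm_on (\<Union>k\<in>K. R k) (\<lambda>i. \<Sum>j\<in>J. a i j * x j) =
        (\<Sum>k\<in>K. sqnorm_on (R k) (\<lambda>i. \<Sum>j\<in>J. a i j * x j))"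
      unfolding sqnorm_on_def using K disj by (intro sum.UNION_disjoint) auto
    also have "\<dots> \<le> (\<Sum>k\<in>K. c k * sqnorm_on J x)"
      using x by (intro sum_mono bound) auto
    finally show ?thesis by (simp add: sum_distrib_right)
  qed
  ultimately show ?thesis by (intro sqnorm_le_codimI[of ?F]) auto
qed

text \<open>
  By Minkowski, the norm of the sum is at most \<open>\<Sum>k. sqrt (c k) * sqrt (X k)\<close>, and Cauchy-Schwarz
  bounds the square of this by the right-hand side.
\<close>

lemma sqnorm_on_sum_le:
  assumes "finite K" and c: "\<And>k. k \<in> K \<Longrightarrow> 0 \<le> c k" and X: "\<And>k. k \<in> K \<Longrightarrow> 0 \<le> X k"
    and le: "\<And>k. k \<in> K \<Longrightarrow> sqnorm_on I (y k) \<le> c k * X k"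
  shows "sqnorm_on I (\<lambda>i. \<Sum>k\<in>K. y k i) \<le> (\<Sum>k\<in>K. c k) * (\<Sum>k\<in>K. X k)"
proof -
  have sq: "sqnorm_on I z = (L2_set (\<lambda>i. cmod (z i)) I)\<^sup>2" for z
    by (simp add: sqnorm_on_def L2_set_def sum_nonneg)
  have "L2_set (\<lambda>i. cmod (\<Sum>k\<in>K. y k i)) I \<le> (\<Sum>k\<in>K. L2_set (\<lambda>i. cmod (y k i)) I)"
    using \<open>finite K\<close>
  proof (induction K)
    case (insert k K)
    have "L2_set (\<lambda>i. cmod (\<Sum>k\<in>insert k K. y k i)) I \<le>
        L2_set (\<lambda>i. cmod (y k i) + cmod (\<Sum>k\<in>K. y k i)) I"
      using insert by (intro L2_set_mono) (auto intro: norm_triangle_ineq)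
    also have "\<dots> \<le> L2_set (\<lambda>i. cmod (y k i)) I + L2_set (\<lambda>i. cmod (\<Sum>k\<in>K. y k i)) I"
      by (rule L2_set_triangle_ineq)
    finally show ?case using insert by simp
  qed (simp add: L2_set_def)
  also have "\<dots> \<le> (\<Sum>k\<in>K. \<bar>sqrt (c k)\<bar> * \<bar>sqrt (X k)\<bar>)"
  proof (rule sum_mono)
    fix k assume k: "k \<in> K"
    have "L2_set (\<lambda>i. cmod (y k i)) I = sqrt (sqnorm_on I (y k))"
      by (simp add: sqnorm_on_def L2_set_def)
    also have "\<dots> \<le> sqrt (c k * X k)" using le[OF k] by simp
    finally show "L2_set (\<lambda>i. cmod (y k i)) I \<le> \<bar>sqrt (c k)\<bar> * \<bar>sqrt (X k)\<bar>"
      using c[OF k] X[OF k] by (simp add: real_sqrt_mult)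
  qed
  also have "\<dots> \<le> L2_set (\<lambda>k. sqrt (c k)) K * L2_set (\<lambda>k. sqrt (X k)) K"
    by (rule L2_set_mult_ineq)
  also have "\<dots> = sqrt ((\<Sum>k\<in>K. c k) * (\<Sum>k\<in>K. X k))"
    using c X by (simp add: L2_set_def real_sqrt_mult)
  finally have "(L2_set (\<lambda>i. cmod (\<Sum>k\<in>K. y k i)) I)\<^sup>2 \<le> (sqrt ((\<Sum>k\<in>K. c k) * (\<Sum>k\<in>K. X k)))\<^sup>2"
    by (intro power_mono L2_set_nonneg)
  then show ?thesis
    using c X by (simp add: sq sum_nonneg)
qed

text \<open>
  The blocks act on the parts of \<open>x\<close> on the disjoint sets \<open>C k\<close>, whose squared norms add up to that
  of \<open>x\<close>; the images overlap, which is what \<open>sqnorm_on_sum_le\<close> handles.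
\<close>

lemma sqnorm_le_codim_concat_columns:
  assumes K: "finite K" "\<And>k. k \<in> K \<Longrightarrow> finite (C k)"
    and disj: "\<And>k l. k \<in> K \<Longrightarrow> l \<in> K \<Longrightarrow> k \<noteq> l \<Longrightarrow> C k \<inter> C l = {}"
    and c: "\<And>k. k \<in> K \<Longrightarrow> 0 \<le> c k"
    and le: "\<And>k. k \<in> K \<Longrightarrow> sqnorm_le_codim a I (C k) (n k) (c k)"
  shows "sqnorm_le_codim a I (\<Union>k\<in>K. C k) (\<Sum>k\<in>K. n k) (\<Sum>k\<in>K. c k)"
proof -
  let ?J = "\<Union>k\<in>K. C k"
  obtain F where F: "\<And>k. k \<in> K \<Longrightarrow> finite (F k)" "\<And>k. k \<in> K \<Longrightarrow> card (F k) \<le> n k"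
    and F_bound: "\<And>k. k \<in> K \<Longrightarrow> sqnorm_le_on_annihilator a I (C k) (F k) (c k)"
    using le unfolding sqnorm_le_codim_def by metis
  note bound = sqnorm_le_on_annihilatorD[OF F_bound]
  \<comment> \<open>A functional for block \<open>k\<close> may be nonzero outside \<open>C k\<close>; cutting it off there makes it a
    condition on that part of \<open>x\<close> alone.\<close>
  define G where "G k = (\<lambda>w j. if j \<in> C k then w j else 0) ` F k" for k
  let ?F = "\<Union>k\<in>K. G k"
  have "finite ?F" using K F by (auto simp: G_def)
  moreover have "card ?F \<le> (\<Sum>k\<in>K. n k)"
  proof -
    have "card (G k) \<le> n k" if "k \<in> K" for k
      using card_image_le[OF F(1)[OF that]] F(2)[OF that] unfolding G_def by (rule order_trans)
    then show ?thesis
      using card_UN_le[OF K(1), of G] sum_mono[of K "\<lambda>k. card (G k)" n] by force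
  qed
  moreover have "sqnorm_on I (\<lambda>i. \<Sum>j\<in>?J. a i j * x j) \<le> (\<Sum>k\<in>K. c k) * sqnorm_on ?J x"
    if x: "\<forall>w\<in>?F. (\<Sum>j\<in>?J. w j * x j) = 0" for x
  proof -
    have split: "sum f ?J = (\<Sum>k\<in>K. sum f (C k))" for f :: "nat \<Rightarrow> 'b::comm_monoid_add"
      using K disj by (intro sum.UNION_disjoint) auto
    have "(\<Sum>j\<in>C k. w j * x j) = 0" if k: "k \<in> K" and w: "w \<in> F k" for k w
    proof -
      have "(\<Sum>j\<in>C k. w j * x j) = (\<Sum>j\<in>?J. (if j \<in> C k then w j else 0) * x j)"
        using K k by (intro sum.mono_neutral_cong_left) auto
      also have "\<dots> = 0" using x k w by (auto simp: G_def)
      finally show ?thesis .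
    qed
    then have "sqnorm_on I (\<lambda>i. \<Sum>k\<in>K. \<Sum>j\<in>C k. a i j * x j) \<le>
        (\<Sum>k\<in>K. c k) * (\<Sum>k\<in>K. sqnorm_on (C k) x)"
      using K c by (intro sqnorm_on_sum_le bound) auto
    moreover have "(\<Sum>k\<in>K. sqnorm_on (C k) x) = sqnorm_on ?J x"
      unfolding sqnorm_on_def by (rule split[symmetric])
    moreover have "(\<lambda>i. \<Sum>j\<in>?J. a i j * x j) = (\<lambda>i. \<Sum>k\<in>K. \<Sum>j\<in>C k. a i j * x j)"
      by (rule ext) (rule split)
    ultimately show ?thesis by simp
  qed
  ultimately show ?thesis by (intro sqnorm_le_codimI[of ?F]) auto
qed

section \<open>Singular values of partitioned matrices\<close>

theorem corollary2p2:
  fixes A :: "complex mat" and d d' r :: nat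
    and R C :: "nat \<Rightarrow> nat set" and j :: "nat \<Rightarrow> nat" and B :: "nat \<Rightarrow> complex mat"
  assumes "A \<in> carrier_mat d d'"
    and "block_partitioning d d' r R C"
    and "\<And>k. k \<in> {1..r} \<Longrightarrow> B k = submatrix A (R k) (C k)"
    and "row_compatible r R \<or> column_compatible r C"
  shows "(sv A ((\<Sum>k=1..r. j k) + 1))\<^sup>2 \<le> (\<Sum>k=1..r. (sv (B k) (j k + 1))\<^sup>2)"
proof (cases "d = 0 \<or> d' = 0")
  \<comment> \<open>An empty array has no blocks, so the strips below would not cover its rows or columns.\<close>
  case True
  then have "sv A ((\<Sum>k=1..r. j k) + 1) = 0" using assms(1) by (auto simp: sv_def)
  then show ?thesis by (simp add: sum_nonneg)
next
  case False
  let ?K = "{1..r}" and ?a = "\<lambda>i j. A $$ (i, j)"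
  let ?c = "\<lambda>k. (sv (B k) (j k + 1))\<^sup>2"
  have cons: "consecutive d (R k)" "consecutive d' (C k)" if "k \<in> ?K" for k
    using assms(2) that by (auto simp: block_partitioning_def)
  have sub: "R k \<subseteq> {..<d}" "C k \<subseteq> {..<d'}" "R k \<noteq> {}" "C k \<noteq> {}" if "k \<in> ?K" for k
    using cons[OF that] by (auto simp: consecutive_def)
  have fin: "finite (R k)" "finite (C k)" if "k \<in> ?K" for k
    using sub[OF that] finite_subset by auto
  have disj: "R k \<inter> R l = {} \<or> C k \<inter> C l = {}" if "k \<in> ?K" "l \<in> ?K" "k \<noteq> l" for k l
    using assms(2) that by (fastforce simp: block_partitioning_def)
  have cover: "\<exists>k\<in>?K. p \<in> R k \<and> q \<in> C k" if "p < d" "q < d'" for p q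
  proof -
    have "(p, q) \<in> (\<Union>k\<in>?K. R k \<times> C k)"
      using assms(2) that by (simp add: block_partitioning_def)
    then show ?thesis by auto
  qed
  have block: "sqnorm_le_codim ?a (R k) (C k) (j k) (?c k)" if "k \<in> ?K" for k
    using sqnorm_le_codim_submatrix[OF assms(1) sub(1,2)] assms(3) that by simp
  have "sqnorm_le_codim ?a {..<d} {..<d'} (\<Sum>k\<in>?K. j k) (\<Sum>k\<in>?K. ?c k)"
    using assms(4)
  proof
    assume compat: "column_compatible r C"
    \<comment> \<open>The blocks on a fixed set \<open>s\<close> of columns fill a vertical strip: a block that meets the strip
      shares a column with it, hence lies on the columns \<open>s\<close> by compatibility.\<close>
    have strip: "sqnorm_le_codim ?a {..<d} s (\<Sum>k\<in>{k\<in>?K. C k = s}. j k) (\<Sum>k\<in>{k\<in>?K. C k = s}. ?c k)"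
      if s: "s \<in> C ` ?K" for s
    proof -
      have "p \<in> (\<Union>k\<in>{k\<in>?K. C k = s}. R k)" if p: "p < d" for p
      proof -
        obtain l q where l: "l \<in> ?K" "s = C l" "q \<in> C l" using s sub(4) by blast
        then have "q < d'" using sub(2) by auto
        then obtain k where k: "k \<in> ?K" "p \<in> R k" "q \<in> C k" using cover[OF p] by blast
        then have "C k = s" using compat l unfolding column_compatible_def by blast
        then show ?thesis using k by auto
      qed
      then have "(\<Union>k\<in>{k\<in>?K. C k = s}. R k) = {..<d}" using sub(1) by blast
      moreover have "sqnorm_le_codim ?a (\<Union>k\<in>{k\<in>?K. C k = s}. R k) s
          (\<Sum>k\<in>{k\<in>?K. C k = s}. j k) (\<Sum>k\<in>{k\<in>?K. C k = s}. ?c k)"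
      proof (rule sqnorm_le_codim_stack_rows)
        show "R k \<inter> R l = {}" if "k \<in> {k\<in>?K. C k = s}" "l \<in> {k\<in>?K. C k = s}" "k \<noteq> l" for k l
          using disj[of k l] sub(4)[of l] that by auto
      qed (use fin block in auto)
      ultimately show ?thesis by simp
    qed
    have "sqnorm_le_codim ?a {..<d} (\<Union>s\<in>C ` ?K. s)
        (\<Sum>s\<in>C ` ?K. \<Sum>k\<in>{k\<in>?K. C k = s}. j k) (\<Sum>s\<in>C ` ?K. \<Sum>k\<in>{k\<in>?K. C k = s}. ?c k)"
    proof (rule sqnorm_le_codim_concat_columns)
      show "s \<inter> t = {}" if "s \<in> C ` ?K" "t \<in> C ` ?K" "s \<noteq> t" for s t
        using that compat unfolding column_compatible_def by blast
      show "finite s" if "s \<in> C ` ?K" for s using that fin(2) by blast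
      show "0 \<le> (\<Sum>k\<in>{k\<in>?K. C k = s}. ?c k)" for s by (simp add: sum_nonneg)
      show "sqnorm_le_codim ?a {..<d} s (\<Sum>k\<in>{k\<in>?K. C k = s}. j k) (\<Sum>k\<in>{k\<in>?K. C k = s}. ?c k)"
        if "s \<in> C ` ?K" for s
        using that by (rule strip)
    qed simp
    moreover have "(\<Union>s\<in>C ` ?K. s) = {..<d'}"
    proof -
      have "q \<in> (\<Union>s\<in>C ` ?K. s)" if "q < d'" for q using cover[of 0 q] that False by auto
      then show ?thesis using sub(2) by blast
    qed
    ultimately show ?thesis
      using sum.image_gen[of ?K j C] sum.image_gen[of ?K ?c C] by simp
  next
    assume compat: "row_compatible r R"
    \<comment> \<open>Likewise the blocks on a fixed set \<open>s\<close> of rows fill a horizontal strip.\<close>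
    have strip: "sqnorm_le_codim ?a s {..<d'} (\<Sum>k\<in>{k\<in>?K. R k = s}. j k) (\<Sum>k\<in>{k\<in>?K. R k = s}. ?c k)"
      if s: "s \<in> R ` ?K" for s
    proof -
      have "q \<in> (\<Union>k\<in>{k\<in>?K. R k = s}. C k)" if q: "q < d'" for q
      proof -
        obtain l p where l: "l \<in> ?K" "s = R l" "p \<in> R l" using s sub(3) by blast
        then have "p < d" using sub(1) by auto
        then obtain k where k: "k \<in> ?K" "p \<in> R k" "q \<in> C k" using cover[of p q] q by blast
        then have "R k = s" using compat l unfolding row_compatible_def by blast
        then show ?thesis using k by auto
      qed
      then have "(\<Union>k\<in>{k\<in>?K. R k = s}. C k) = {..<d'}" using sub(2) by blast
      moreover have "sqnorm_le_codim ?a s (\<Union>k\<in>{k\<in>?K. R k = s}. C k)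
          (\<Sum>k\<in>{k\<in>?K. R k = s}. j k) (\<Sum>k\<in>{k\<in>?K. R k = s}. ?c k)"
      proof (rule sqnorm_le_codim_concat_columns)
        show "C k \<inter> C l = {}" if "k \<in> {k\<in>?K. R k = s}" "l \<in> {k\<in>?K. R k = s}" "k \<noteq> l" for k l
          using disj[of k l] sub(3)[of l] that by auto
      qed (use fin block in auto)
      ultimately show ?thesis by simp
    qed
    have "sqnorm_le_codim ?a (\<Union>s\<in>R ` ?K. s) {..<d'}
        (\<Sum>s\<in>R ` ?K. \<Sum>k\<in>{k\<in>?K. R k = s}. j k) (\<Sum>s\<in>R ` ?K. \<Sum>k\<in>{k\<in>?K. R k = s}. ?c k)"
    proof (rule sqnorm_le_codim_stack_rows)
      show "s \<inter> t = {}" if "s \<in> R ` ?K" "t \<in> R ` ?K" "s \<noteq> t" for s t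
        using that compat unfolding row_compatible_def by blast
      show "finite s" if "s \<in> R ` ?K" for s using that fin(1) by blast
      show "sqnorm_le_codim ?a s {..<d'} (\<Sum>k\<in>{k\<in>?K. R k = s}. j k) (\<Sum>k\<in>{k\<in>?K. R k = s}. ?c k)"
        if "s \<in> R ` ?K" for s
        using that by (rule strip)
    qed simp
    moreover have "(\<Union>s\<in>R ` ?K. s) = {..<d}"
    proof -
      have "p \<in> (\<Union>s\<in>R ` ?K. s)" if "p < d" for p using cover[of p 0] that False by auto
      then show ?thesis using sub(1) by blast
    qed
    ultimately show ?thesis
      using sum.image_gen[of ?K j R] sum.image_gen[of ?K ?c R] by simp
  qed
  then show ?thesis
    using sv_sq_le_if_sqnorm_le_codim[OF assms(1)] by (simp add: sum_nonneg)
qed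

end
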